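(* Let $k\geq 1$ be an ordinal and let $\lambda<\omega_k$ be a limit ordinal. Let $(\phi_\mu)_{\mu<\lambda}$ be a sequence of normal functions of class $k$, each of whose value set $V\phi_\mu$ consists only of limit ordinals, such that for every $\mu$ with $1\leq\mu<\lambda$, $$V\phi_\mu=\bigcap_{\nu<\mu} V\phi'_\nu .$$ Let $\psi$ be the normal function of class $k$ whose value set is $V\psi=\bigcap_{\mu<\lambda}V\phi_\mu$. Then for every strictly increasing sequence $(\lambda_\nu)_{\nu<\pi}$ of ordinals $<\lambda$, whose length $\pi$ is a limit ordinal and with $\sup_{\nu<\pi}\lambda_\nu=\lambda$, we have $$\psi(1)=\sup_{\nu<\pi}\phi_{\lambda_\nu}(1),\qquad \psi(x+1)=\sup_{\nu<\pi}\phi_{\lambda_\nu}(\psi(x)+1)\ \text{ for all } x \text{ with } 1\leq x<\omega_k,$$ and the sequences $(\phi_{\lambda_\nu}(1))_{\nu<\pi}$ and $(\phi_{\lambda_\nu}(\psi(x)+1))_{\nu<\pi}$ are strictly increasing.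
   Context: All objects are ordinals. $\omega_0=\omega$, $\omega_1=\Omega$ (the first uncountable ordinal), and in general $\omega_k$ is the $k$-th infinite initial ordinal. A normal function of class $k$ ($k\geq1$) is a function $\phi$ defined on all ordinals $x$ with $1\leq x<\omega_k$, with values in this same set, which is strictly increasing and continuous: for every limit ordinal $x<\omega_k$, $\phi(x)=\sup_{1\leq x'<x}\phi(x')$. $V\phi$ denotes the value set (range) of $\phi$. For a normal function $\phi$ of class $k$, its derivative $\phi'$ is the normal function of class $k$ enumerating in increasing order the critical points (fixed points, $\phi(x)=x$) of $\phi$. *)

theory Defs
  imports Main "HOL-Library.Equipollence" "HOL-Library.Lub_Glb"
begin

text \<open>
  Ordinals are the elements of an arbitrary type \<open>'o\<close> of class \<^class>\<open>wellorder\<close>, i.e. of an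
  arbitrary initial segment of the ordinals up to isomorphism. An ordinal \<open>x\<close> corresponds to the
  order type of \<open>{..<x}\<close>.
\<close>

definition ord_zero :: "'o::wellorder" where
  "ord_zero = (LEAST x. True)"

text \<open>Unspecified on a greatest element of \<open>'o\<close>.\<close>

definition ord_succ :: "'o::wellorder \<Rightarrow> 'o" where
  "ord_succ x = (LEAST y. x < y)"

definition ord_one :: "'o::wellorder" where
  "ord_one = ord_succ ord_zero"

definition limit_ord :: "'o::wellorder \<Rightarrow> bool" where
  "limit_ord x \<longleftrightarrow> x \<noteq> ord_zero \<and> (\<forall>y<x. ord_succ y < x)"

text \<open>A predicate, so that no value is assigned to the supremum of an unbounded set.\<close>

abbreviation is_sup :: "'o::wellorder set \<Rightarrow> 'o \<Rightarrow> bool" where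
  "is_sup A s \<equiv> isLub UNIV A s"

definition infinite_initial :: "'o::wellorder \<Rightarrow> bool" where
  "infinite_initial x \<longleftrightarrow> infinite {..<x} \<and> (\<forall>y<x. \<not> {..<y} \<approx> {..<x})"

text \<open>
  \<open>w = \<omega>\<^sub>k\<close>, counting from \<open>\<omega>\<^sub>0 = \<omega>\<close>: the infinite initial ordinals
  below \<open>w\<close> form a set of order type \<open>k\<close>. A relation, since \<open>'o\<close> need not reach \<open>\<omega>\<^sub>k\<close>.
\<close>

definition is_omega :: "'o::wellorder \<Rightarrow> 'o \<Rightarrow> bool" where
  "is_omega k w \<longleftrightarrow> infinite_initial w \<and>
     (\<exists>f. strict_mono_on {..<k} f \<and> f ` {..<k} = {x. infinite_initial x \<and> x < w})"

text \<open>
  In the following definitions \<open>w\<close> stands for \<open>\<omega>\<^sub>k\<close>. Functions are total in HOL; their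
  values outside \<open>ord_dom w\<close> play no role.
\<close>

definition ord_dom :: "'o::wellorder \<Rightarrow> 'o set" where
  "ord_dom w = {x. ord_one \<le> x \<and> x < w}"

definition value_set :: "'o::wellorder \<Rightarrow> ('o \<Rightarrow> 'o) \<Rightarrow> 'o set" where
  "value_set w f = f ` ord_dom w"

definition normal_fun :: "'o::wellorder \<Rightarrow> ('o \<Rightarrow> 'o) \<Rightarrow> bool" where
  "normal_fun w f \<longleftrightarrow>
     (\<forall>x\<in>ord_dom w. f x \<in> ord_dom w) \<and>
     strict_mono_on (ord_dom w) f \<and>
     (\<forall>x<w. limit_ord x \<longrightarrow> is_sup (f ` {ord_one..<x}) (f x))"

text \<open>A normal function is determined on \<open>ord_dom w\<close> by its value set.\<close>

definition is_derivative :: "'o::wellorder \<Rightarrow> ('o \<Rightarrow> 'o) \<Rightarrow> ('o \<Rightarrow> 'o) \<Rightarrow> bool" where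
  "is_derivative w f f' \<longleftrightarrow>
     normal_fun w f' \<and> value_set w f' = {x \<in> ord_dom w. f x = x}"

end

theory Submission
  imports Defs
begin

text \<open>
  For \<open>\<nu> < \<mu>\<close> every value of \<open>\<phi> \<mu>\<close> is a fixed point of \<open>\<phi> \<nu>\<close>. Put \<open>c = d + 1\<close>, with \<open>d = 0\<close> or
  \<open>d = \<psi> x\<close>. The values \<open>\<phi> \<mu> c \<ge> c\<close> are limits, hence exceed the successor \<open>c\<close>, so
  \<open>\<phi> \<nu> c < \<phi> \<nu> (\<phi> \<mu> c) = \<phi> \<mu> c\<close> for \<open>\<nu> < \<mu>\<close>. The supremum \<open>s\<close> of such a chain along a cofinal
  sequence is a limit of fixed points of each \<open>\<phi> \<mu>\<close>, hence by continuity a fixed point itself,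
  and so a value of \<open>\<psi>\<close> exceeding \<open>d\<close>. Conversely the least value of \<open>\<psi>\<close> above \<open>d\<close> is a fixed
  point of all \<open>\<phi> \<mu>\<close> and therefore bounds the chain.
\<close>

section \<open>Successor and limit ordinals in a well-order\<close>

lemma ord_zero_le: "ord_zero \<le> x"
  unfolding ord_zero_def by (rule Least_le) simp

text \<open>The witness \<open>y\<close> rules out that \<open>x\<close> is a greatest element,
  where \<open>ord_succ\<close> is unspecified.\<close>

lemma less_ord_succ: "x < y \<Longrightarrow> x < ord_succ x"
  unfolding ord_succ_def by (rule LeastI)

lemma ord_succ_leI: "x < y \<Longrightarrow> ord_succ x \<le> y"
  unfolding ord_succ_def by (rule Least_le)

lemma less_ord_succ_iff_le: "x < z \<Longrightarrow> y < ord_succ x \<longleftrightarrow> y \<le> x"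
  using less_ord_succ[of x z] ord_succ_leI[of x y] by (metis leD le_less_trans not_le)

lemma limit_ord_succ_less: "limit_ord x \<Longrightarrow> y < x \<Longrightarrow> ord_succ y < x"
  by (simp add: limit_ord_def)

lemma limit_ord_gt_zero: "limit_ord x \<Longrightarrow> ord_zero < x"
  using ord_zero_le[of x] by (auto simp: limit_ord_def)

text \<open>If \<open>w\<close> were the successor of \<open>y\<close>, then \<open>{..<w}\<close>
  would be the infinite set \<open>{..<y}\<close> with one element added, hence equipollent to it,
  against initiality. This keeps \<open>ord_dom w\<close> closed under successors.\<close>

lemma infinite_initial_limit_ord:
  assumes "infinite_initial w"
  shows "limit_ord w"
proof -
  have inf: "infinite {..<w}" and init: "\<And>y. y < w \<Longrightarrow> \<not> {..<y} \<approx> {..<w}"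
    using assms by (auto simp: infinite_initial_def)
  have "w \<noteq> ord_zero"
  proof
    assume "w = ord_zero"
    then have "{..<w} = {}" by (simp add: set_eq_iff not_less ord_zero_le)
    with inf show False by simp
  qed
  moreover have "ord_succ y < w" if "y < w" for y
  proof (rule ccontr)
    assume "\<not> ord_succ y < w"
    with ord_succ_leI[OF that] have "w = ord_succ y" by simp
    then have eq: "{..<w} = insert y {..<y}"
      by (simp only: set_eq_iff lessThan_iff insert_iff less_ord_succ_iff_le[OF that])
        (auto simp: le_less)
    with inf have "infinite {..<y}" by simp
    then have "insert y {..<y} \<approx> {..<y}" by (rule infinite_insert_eqpoll)
    with eq have "{..<y} \<approx> {..<w}" by (simp add: eqpoll_sym)
    with init that show False by blast
  qed
  ultimately show ?thesis by (simp add: limit_ord_def)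
qed

section \<open>Suprema\<close>

lemma is_sup_upper: "is_sup A s \<Longrightarrow> a \<in> A \<Longrightarrow> a \<le> s"
  by (auto simp: isLub_def leastP_def isUb_def setle_def)

lemma is_sup_least: "is_sup A s \<Longrightarrow> (\<And>a. a \<in> A \<Longrightarrow> a \<le> u) \<Longrightarrow> s \<le> u"
  by (auto simp: isLub_def leastP_def isUb_def setle_def setge_def)

lemma is_supI:
  "(\<And>a. a \<in> A \<Longrightarrow> a \<le> s) \<Longrightarrow> (\<And>u. (\<And>a. a \<in> A \<Longrightarrow> a \<le> u) \<Longrightarrow> s \<le> u) \<Longrightarrow> is_sup A s"
  by (auto simp: isLub_def leastP_def isUb_def setle_def setge_def)

text \<open>The well-order supplies a least upper bound as soon as there is any;
  \<open>s \<le> b\<close> later keeps the supremum below \<open>w\<close>.\<close>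

lemma is_sup_exists:
  fixes b :: "'o::wellorder"
  assumes "\<And>a. a \<in> A \<Longrightarrow> a \<le> b"
  shows "\<exists>s\<le>b. is_sup A s"
proof -
  let ?s = "LEAST u. \<forall>a\<in>A. a \<le> u"
  have "\<forall>a\<in>A. a \<le> ?s" by (rule LeastI[of _ b]) (use assms in blast)
  moreover have "?s \<le> u" if "\<And>a. a \<in> A \<Longrightarrow> a \<le> u" for u
    by (rule Least_le) (use that in blast)
  ultimately show ?thesis using assms by (intro exI[of _ ?s] conjI is_supI) auto
qed

lemma less_is_supD: "is_sup A s \<Longrightarrow> y < s \<Longrightarrow> \<exists>a\<in>A. y < a"
  using is_sup_least[of A s y] by (meson not_le)

section \<open>Normal functions\<close>

lemma normal_fun_dom: "normal_fun w f \<Longrightarrow> x \<in> ord_dom w \<Longrightarrow> f x \<in> ord_dom w"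
  by (simp add: normal_fun_def)

lemma normal_fun_less:
  "normal_fun w f \<Longrightarrow> x \<in> ord_dom w \<Longrightarrow> y \<in> ord_dom w \<Longrightarrow> f x < f y \<longleftrightarrow> x < y"
  using strict_mono_onD[of "ord_dom w" f x y] strict_mono_onD[of "ord_dom w" f y x]
  by (cases x y rule: linorder_cases) (auto simp: normal_fun_def)

lemma normal_fun_le:
  "normal_fun w f \<Longrightarrow> x \<in> ord_dom w \<Longrightarrow> y \<in> ord_dom w \<Longrightarrow> f x \<le> f y \<longleftrightarrow> x \<le> y"
  using normal_fun_less[of w f y x] by (simp flip: not_less)

lemma normal_fun_ge:
  assumes f: "normal_fun w f" and x: "x \<in> ord_dom w"
  shows "x \<le> f x"
  using x
proof (induction x rule: less_induct)
  case (less x)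
  show ?case
  proof (rule ccontr)
    assume lt: "\<not> x \<le> f x"
    have fx: "f x \<in> ord_dom w" using f less.prems by (rule normal_fun_dom)
    \<comment> \<open>The induction hypothesis is used at the smaller argument \<open>f x\<close>;
      cancelling \<open>f\<close> then returns \<open>x \<le> f x\<close>.\<close>
    with less.IH lt have "f x \<le> f (f x)" by simp
    with normal_fun_le[OF f less.prems fx] lt show False by simp
  qed
qed

lemma normal_fun_limit:
  "normal_fun w f \<Longrightarrow> x < w \<Longrightarrow> limit_ord x \<Longrightarrow> is_sup (f ` {ord_one..<x}) (f x)"
  by (simp add: normal_fun_def)

text \<open>Common setting for the values at \<open>1\<close> and at successors. The hypotheses on
  derivatives enter in the form \<open>fixed\<close>.\<close>

locale critical_hierarchy =
  fixes w l p :: "'o::wellorder" and \<phi> :: "'o \<Rightarrow> 'o \<Rightarrow> 'o" and L :: "'o \<Rightarrow> 'o"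
  assumes w: "limit_ord w"
    and l: "limit_ord l"
    and normal: "\<And>\<mu>. \<mu> < l \<Longrightarrow> normal_fun w (\<phi> \<mu>)"
    and limit_values: "\<And>\<mu> y. \<mu> < l \<Longrightarrow> y \<in> value_set w (\<phi> \<mu>) \<Longrightarrow> limit_ord y"
    and fixed: "\<And>\<nu> \<mu> y. \<nu> < \<mu> \<Longrightarrow> \<mu> < l \<Longrightarrow> y \<in> value_set w (\<phi> \<mu>) \<Longrightarrow> \<phi> \<nu> y = y"
    and L_less: "\<And>\<nu>. \<nu> < p \<Longrightarrow> L \<nu> < l"
    and L_mono: "strict_mono_on {..<p} L"
    and L_sup: "is_sup (L ` {..<p}) l"
begin

section \<open>The chain of values at a successor argument\<close>

lemma succ_dom:
  assumes "d < w"
  shows "ord_succ d \<in> ord_dom w"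
proof -
  have "ord_succ d < w" using w assms by (rule limit_ord_succ_less)
  moreover have "ord_zero < ord_succ d"
    using ord_zero_le[of d] less_ord_succ[OF assms] by simp
  then have "ord_one \<le> ord_succ d" unfolding ord_one_def by (rule ord_succ_leI)
  ultimately show ?thesis by (simp add: ord_dom_def)
qed

lemma value_in_value_set: "x \<in> ord_dom w \<Longrightarrow> \<phi> \<mu> x \<in> value_set w (\<phi> \<mu>)"
  by (simp add: value_set_def)

lemma value_dom: "\<mu> < l \<Longrightarrow> x \<in> ord_dom w \<Longrightarrow> \<phi> \<mu> x \<in> ord_dom w"
  by (rule normal_fun_dom[OF normal])

text \<open>The value is a limit ordinal above \<open>d\<close>, so it lies above the successor of
  \<open>d\<close> as well.\<close>

lemma succ_less_value:
  assumes "\<mu> < l" "d < w"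
  shows "ord_succ d < \<phi> \<mu> (ord_succ d)"
proof -
  have "d < ord_succ d" using assms(2) by (rule less_ord_succ)
  also have "\<dots> \<le> \<phi> \<mu> (ord_succ d)"
    using normal[OF assms(1)] succ_dom[OF assms(2)] by (rule normal_fun_ge)
  finally show ?thesis
    using limit_ord_succ_less limit_values assms(1) value_in_value_set succ_dom[OF assms(2)]
    by blast
qed

lemma value_succ_less:
  assumes "\<nu> < \<mu>" "\<mu> < l" "d < w"
  shows "\<phi> \<nu> (ord_succ d) < \<phi> \<mu> (ord_succ d)"
proof -
  let ?c = "ord_succ d"
  have c: "?c \<in> ord_dom w" using assms(3) by (rule succ_dom)
  have "\<phi> \<nu> ?c < \<phi> \<nu> (\<phi> \<mu> ?c)"
    using succ_less_value[OF assms(2,3)] normal_fun_less[OF normal] c value_dom[OF assms(2) c]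
      assms(1,2) by simp
  also have "\<dots> = \<phi> \<mu> ?c"
    using assms(1,2) value_in_value_set[OF c] by (rule fixed)
  finally show ?thesis .
qed

lemma values_succ_strict_mono: "d < w \<Longrightarrow> strict_mono_on {..<p} (\<lambda>\<nu>. \<phi> (L \<nu>) (ord_succ d))"
  using L_mono L_less by (auto simp: strict_mono_on_def intro!: value_succ_less)

lemma L_cofinal: "\<mu> < l \<Longrightarrow> \<exists>\<nu><p. \<mu> < L \<nu>"
  using less_is_supD[OF L_sup] by blast

text \<open>Upper bound for the chain: \<open>\<phi> \<mu>\<close> is monotone and fixes
  \<open>z\<close>.\<close>

lemma values_succ_le:
  assumes "\<mu> < l" "d < z" and z: "z \<in> (\<Inter>\<mu>\<in>{..<l}. value_set w (\<phi> \<mu>))"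
  shows "\<phi> \<mu> (ord_succ d) \<le> z"
proof -
  \<comment> \<open>Being a value of \<open>\<phi> \<mu>\<close> does not make \<open>z\<close> a
    fixed point of it, but being a value at the next index does; that index is available because
    \<open>l\<close> is a limit.\<close>
  have succ: "ord_succ \<mu> < l" using l assms(1) by (rule limit_ord_succ_less)
  have "z \<in> value_set w (\<phi> \<mu>)" using z assms(1) by blast
  then have zd: "z \<in> ord_dom w" using value_dom[OF assms(1)] by (auto simp: value_set_def)
  then have "d < w" using assms(2) by (auto simp: ord_dom_def)
  then have "\<phi> \<mu> (ord_succ d) \<le> \<phi> \<mu> z"
    using normal_fun_le[OF normal[OF assms(1)] succ_dom zd] ord_succ_leI[OF assms(2)] by blast
  also have "\<dots> = z"
    using fixed[OF less_ord_succ[OF assms(1)] succ] z succ by blast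
  finally show ?thesis .
qed

lemma sup_values_succ_in_values:
  assumes "d < w" "s < w"
    and s: "is_sup ((\<lambda>\<nu>. \<phi> (L \<nu>) (ord_succ d)) ` {..<p}) s"
  shows "d < s" and "s \<in> (\<Inter>\<mu>\<in>{..<l}. value_set w (\<phi> \<mu>))"
proof -
  let ?t = "\<lambda>\<nu>. \<phi> (L \<nu>) (ord_succ d)"
  have c: "ord_succ d \<in> ord_dom w" using assms(1) by (rule succ_dom)
  have t_le: "?t \<nu> \<le> s" if "\<nu> < p" for \<nu> using is_sup_upper[OF s] that by blast
  \<comment> \<open>Some member of the chain is needed to place \<open>s\<close> above the successor
    of \<open>d\<close>.\<close>
  obtain \<nu>0 where \<nu>0: "\<nu>0 < p" using L_cofinal limit_ord_gt_zero[OF l] by blast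
  have "d < ord_succ d" using assms(1) by (rule less_ord_succ)
  also have c_less: "ord_succ d < s"
    using succ_less_value[OF L_less[OF \<nu>0] assms(1)] t_le[OF \<nu>0] by simp
  finally show "d < s" .
  have sd: "s \<in> ord_dom w" using c c_less assms(2) by (auto simp: ord_dom_def)
  \<comment> \<open>Each of the two conditions holds at some index; since \<open>L\<close> and the
    chain both increase, the larger of the two indices meets both.\<close>
  have above: "\<exists>\<nu><p. \<mu> < L \<nu> \<and> x < ?t \<nu>" if \<mu>: "\<mu> < l" and x: "x < s" for \<mu> x
  proof -
    obtain \<nu>1 where \<nu>1: "\<nu>1 < p" "\<mu> < L \<nu>1" using L_cofinal[OF \<mu>] by blast
    obtain \<nu>2 where \<nu>2: "\<nu>2 < p" "x < ?t \<nu>2" using less_is_supD[OF s x] by blast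
    show ?thesis
    proof (cases "\<nu>1 < \<nu>2")
      case True
      then have "L \<nu>1 < L \<nu>2" using strict_mono_onD[OF L_mono] \<nu>1 \<nu>2 by simp
      with \<nu>1 \<nu>2 show ?thesis by (intro exI[of _ \<nu>2]) auto
    next
      case False
      then have "?t \<nu>2 \<le> ?t \<nu>1"
        using strict_mono_onD[OF values_succ_strict_mono[OF assms(1)], of \<nu>2 \<nu>1] \<nu>1 \<nu>2
        by (cases \<nu>1 \<nu>2 rule: linorder_cases) auto
      with \<nu>1 \<nu>2 show ?thesis by (intro exI[of _ \<nu>1]) auto
    qed
  qed
  have s_limit: "limit_ord s"
    unfolding limit_ord_def
  proof (intro conjI allI impI)
    show "s \<noteq> ord_zero" using c_less ord_zero_le by (metis not_le)
    fix y assume "y < s"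
    then obtain \<nu> where \<nu>: "\<nu> < p" "y < ?t \<nu>" using less_is_supD[OF s] by blast
    have "limit_ord (?t \<nu>)" using limit_values[OF L_less[OF \<nu>(1)] value_in_value_set[OF c]] .
    then have "ord_succ y < ?t \<nu>" using \<nu>(2) by (rule limit_ord_succ_less)
    with t_le[OF \<nu>(1)] show "ord_succ y < s" by simp
  qed
  have "\<phi> \<mu> s = s" if \<mu>: "\<mu> < l" for \<mu>
  proof (rule antisym)
    show "s \<le> \<phi> \<mu> s" using normal[OF \<mu>] sd by (rule normal_fun_ge)
    \<comment> \<open>By continuity it suffices to bound \<open>\<phi> \<mu> x\<close> for
      \<open>x < s\<close>. Such an \<open>x\<close> lies below a chain member that
      \<open>\<phi> \<mu>\<close> fixes.\<close>
    show "\<phi> \<mu> s \<le> s"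
    proof (rule is_sup_least[OF normal_fun_limit[OF normal[OF \<mu>] assms(2) s_limit]])
      fix a assume "a \<in> \<phi> \<mu> ` {ord_one..<s}"
      then obtain x where x: "ord_one \<le> x" "x < s" and a: "a = \<phi> \<mu> x" by auto
      obtain \<nu> where \<nu>: "\<nu> < p" "\<mu> < L \<nu>" "x < ?t \<nu>" using above[OF \<mu> x(2)] by blast
      have "x \<in> ord_dom w" using x assms(2) by (auto simp: ord_dom_def)
      then have "a \<le> \<phi> \<mu> (?t \<nu>)"
        using normal_fun_le[OF normal[OF \<mu>] _ value_dom[OF L_less[OF \<nu>(1)] c]] \<nu>(3) a by simp
      also have "\<dots> = ?t \<nu>"
        using \<nu>(2) L_less[OF \<nu>(1)] value_in_value_set[OF c] by (rule fixed)
      finally show "a \<le> s" using t_le[OF \<nu>(1)] by simp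
    qed
  qed
  then show "s \<in> (\<Inter>\<mu>\<in>{..<l}. value_set w (\<phi> \<mu>))"
    using value_in_value_set[OF sd] by (metis INT_I lessThan_iff)
qed

text \<open>The chain is bounded by \<open>z\<close>, so its supremum \<open>s\<close> exists and is
  at most \<open>z\<close>; as \<open>s\<close> is itself a common value above \<open>d\<close>,
  leastness gives equality.\<close>

lemma sup_values_succ:
  assumes "d < z" and z: "z \<in> (\<Inter>\<mu>\<in>{..<l}. value_set w (\<phi> \<mu>))"
    and least: "\<And>y. y \<in> (\<Inter>\<mu>\<in>{..<l}. value_set w (\<phi> \<mu>)) \<Longrightarrow> d < y \<Longrightarrow> z \<le> y"
  shows "is_sup ((\<lambda>\<nu>. \<phi> (L \<nu>) (ord_succ d)) ` {..<p}) z"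
proof -
  have "z \<in> value_set w (\<phi> ord_zero)" using z limit_ord_gt_zero[OF l] by blast
  then have zw: "z < w"
    using value_dom[OF limit_ord_gt_zero[OF l]] by (auto simp: value_set_def ord_dom_def)
  obtain s where s: "s \<le> z" "is_sup ((\<lambda>\<nu>. \<phi> (L \<nu>) (ord_succ d)) ` {..<p}) s"
    using is_sup_exists[of "(\<lambda>\<nu>. \<phi> (L \<nu>) (ord_succ d)) ` {..<p}" z]
      values_succ_le[OF L_less assms(1) z] by blast
  have "d < w" "s < w" using s(1) zw assms(1) by auto
  from sup_values_succ_in_values[OF this s(2)] have "z \<le> s" using least by blast
  with s show ?thesis by simp
qed

end

section \<open>Common values enumerated by \<open>\<psi>\<close>\<close>

theorem theorem3:
  fixes k w l p :: "'o::wellorder"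
    and \<phi> \<phi>' :: "'o \<Rightarrow> 'o \<Rightarrow> 'o"
    and \<psi> :: "'o \<Rightarrow> 'o"
    and L :: "'o \<Rightarrow> 'o"
  assumes k: "ord_one \<le> k"
    and w: "is_omega k w"
    and l: "limit_ord l" "l < w"
    and normal: "\<And>\<mu>. \<mu> < l \<Longrightarrow> normal_fun w (\<phi> \<mu>)"
    and limit_values: "\<And>\<mu> y. \<mu> < l \<Longrightarrow> y \<in> value_set w (\<phi> \<mu>) \<Longrightarrow> limit_ord y"
    and derivative: "\<And>\<mu>. \<mu> < l \<Longrightarrow> is_derivative w (\<phi> \<mu>) (\<phi>' \<mu>)"
    and val_sets: "\<And>\<mu>. ord_one \<le> \<mu> \<Longrightarrow> \<mu> < l \<Longrightarrow>
                     value_set w (\<phi> \<mu>) = (\<Inter>\<nu>\<in>{..<\<mu>}. value_set w (\<phi>' \<nu>))"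
    and psi: "normal_fun w \<psi>" "value_set w \<psi> = (\<Inter>\<mu>\<in>{..<l}. value_set w (\<phi> \<mu>))"
    and p: "limit_ord p"
    and L: "\<And>\<nu>. \<nu> < p \<Longrightarrow> L \<nu> < l" "strict_mono_on {..<p} L" "is_sup (L ` {..<p}) l"
  shows "is_sup ((\<lambda>\<nu>. \<phi> (L \<nu>) ord_one) ` {..<p}) (\<psi> ord_one) \<and>
         (\<forall>x\<in>ord_dom w.
            is_sup ((\<lambda>\<nu>. \<phi> (L \<nu>) (ord_succ (\<psi> x))) ` {..<p}) (\<psi> (ord_succ x))) \<and>
         strict_mono_on {..<p} (\<lambda>\<nu>. \<phi> (L \<nu>) ord_one) \<and>
         (\<forall>x\<in>ord_dom w. strict_mono_on {..<p} (\<lambda>\<nu>. \<phi> (L \<nu>) (ord_succ (\<psi> x))))"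
proof -
  have w_limit: "limit_ord w"
    using w by (simp add: is_omega_def infinite_initial_limit_ord)
  have "\<phi> \<nu> y = y" if "\<nu> < \<mu>" "\<mu> < l" "y \<in> value_set w (\<phi> \<mu>)" for \<nu> \<mu> y
  proof -
    \<comment> \<open>An index above some \<open>\<nu>\<close> is at least one, so
      \<open>val_sets\<close> applies and \<open>y\<close> is a value of the derivative of
      \<open>\<phi> \<nu>\<close>.\<close>
    have "ord_one \<le> \<mu>"
      unfolding ord_one_def using ord_zero_le[of \<nu>] that(1) by (intro ord_succ_leI) simp
    with val_sets that have "y \<in> value_set w (\<phi>' \<nu>)" by blast
    with derivative[of \<nu>] that show ?thesis by (auto simp: is_derivative_def)
  qed
  then interpret critical_hierarchy w l p \<phi> L
    using w_limit l normal limit_values L by unfold_locales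
  have zero: "ord_zero < w" using w_limit by (rule limit_ord_gt_zero)
  then have one: "ord_one \<in> ord_dom w" unfolding ord_one_def by (rule succ_dom)
  have psi_value: "\<psi> x \<in> (\<Inter>\<mu>\<in>{..<l}. value_set w (\<phi> \<mu>))" if "x \<in> ord_dom w" for x
    using psi(2) that by (auto simp: value_set_def)
  \<comment> \<open>The case \<open>d = ord_zero\<close>: \<open>\<psi> ord_one\<close> is the least
    common value, and the successor of \<open>d\<close> is \<open>ord_one\<close> by
    definition.\<close>
  have sup_one: "is_sup ((\<lambda>\<nu>. \<phi> (L \<nu>) ord_one) ` {..<p}) (\<psi> ord_one)"
    unfolding ord_one_def
  proof (rule sup_values_succ; fold ord_one_def)
    have "ord_zero < (ord_one :: 'o)" unfolding ord_one_def using zero by (rule less_ord_succ)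
    also have "ord_one \<le> \<psi> ord_one" using psi(1) one by (rule normal_fun_ge)
    finally show "ord_zero < \<psi> ord_one" .
    show "\<psi> ord_one \<in> (\<Inter>\<mu>\<in>{..<l}. value_set w (\<phi> \<mu>))" using one by (rule psi_value)
    fix y assume "y \<in> (\<Inter>\<mu>\<in>{..<l}. value_set w (\<phi> \<mu>))"
    then obtain u where u: "u \<in> ord_dom w" "y = \<psi> u"
      unfolding psi(2)[symmetric] by (auto simp: value_set_def)
    then show "\<psi> ord_one \<le> y"
      using normal_fun_le[OF psi(1) one u(1)] by (simp add: ord_dom_def)
  qed
  have psi_less: "\<psi> x < w" if "x \<in> ord_dom w" for x
    using normal_fun_dom[OF psi(1) that] by (simp add: ord_dom_def)
  \<comment> \<open>The case \<open>d = \<psi> x\<close>: a common value above \<open>d\<close> is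
    \<open>\<psi> u\<close> with \<open>x < u\<close>, so \<open>u\<close> is at least the successor
    of \<open>x\<close>.\<close>
  have sup_succ: "is_sup ((\<lambda>\<nu>. \<phi> (L \<nu>) (ord_succ (\<psi> x))) ` {..<p}) (\<psi> (ord_succ x))"
    if x: "x \<in> ord_dom w" for x
  proof (rule sup_values_succ)
    have xw: "x < w" using x by (simp add: ord_dom_def)
    then have succ: "ord_succ x \<in> ord_dom w" by (rule succ_dom)
    show "\<psi> x < \<psi> (ord_succ x)"
      using normal_fun_less[OF psi(1) x succ] less_ord_succ[OF xw] by simp
    show "\<psi> (ord_succ x) \<in> (\<Inter>\<mu>\<in>{..<l}. value_set w (\<phi> \<mu>))" using succ by (rule psi_value)
    fix y assume "y \<in> (\<Inter>\<mu>\<in>{..<l}. value_set w (\<phi> \<mu>))" and less: "\<psi> x < y"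
    then obtain u where u: "u \<in> ord_dom w" "y = \<psi> u"
      unfolding psi(2)[symmetric] by (auto simp: value_set_def)
    with less have "x < u" using normal_fun_less[OF psi(1) x u(1)] by simp
    then show "\<psi> (ord_succ x) \<le> y"
      using normal_fun_le[OF psi(1) succ u(1)] ord_succ_leI u(2) by blast
  qed
  show ?thesis
    using sup_one sup_succ values_succ_strict_mono[OF zero, folded ord_one_def]
      values_succ_strict_mono[OF psi_less] by blast
qed

end
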